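(* Let $8<m\le n$ and $t<\frac m4-2$ be positive integers, and let $\mu$ and $L_A$ be positive numbers. Then for any first-order method $\mathcal M$ (as defined in the context), there exists an instance of the bilinear saddle-point problem $\min_{x\in X}\max_{y\in Y} f(x)+\langle Ax-b,y\rangle-g(y)$ (with $A\in\mathbb R^{m\times n}$) such that $f$ is $\mu$-strongly convex, $\|A\|=L_A$, $X$ and $Y$ are Euclidean balls with radii $R_X$ and $R_Y$ respectively (the radii being part of the instance), and the associated primal problem $\min_{x\in X}\phi(x)$ has a unique optimal solution $\hat x\in X$. In addition, $$\|\bar x^{(t)}-\hat x\|^2\ \ge\ \frac{5L_A^2R_Y^2}{256\,\mu^2(4t+9)^2}$$ and $$\phi(\bar x^{(t)})-\psi(\bar y^{(t)})\ \ge\ \frac{5L_A^2R_Y^2}{512\,\mu(4t+9)^2},$$ where $\phi$ and $\psi$ are the associated primal and dual objective functions, and $(\bar x^{(t)},\bar y^{(t)})$ is the approximate solution output by $\mathcal M$ applied to the instance.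
   Context: $\|\cdot\|$ is the Euclidean norm of vectors and the spectral norm of matrices. Bilinear saddle-point problem: $\min_{x\in X}\max_{y\in Y} f(x)+\langle Ax-b,y\rangle-g(y)$, with $X\subseteq\mathbb R^n$, $Y\subseteq\mathbb R^m$ closed convex, $f:\mathbb R^n\to\mathbb R$, $g:\mathbb R^m\to\mathbb R$ closed convex, $f$ differentiable with Lipschitz gradient, $A\in\mathbb R^{m\times n}$, $b\in\mathbb R^m$. Primal objective: $\phi(x)=f(x)+\max_{y\in Y}\{\langle Ax-b,y\rangle-g(y)\}$. Dual objective: $\psi(y)=-g(y)+\min_{x\in X}\{\langle Ax-b,y\rangle+f(x)\}$. $f$ is $\mu$-strongly convex if $\langle\nabla f(x_1)-\nabla f(x_2),x_1-x_2\rangle\ge\mu\|x_1-x_2\|^2$ for all $x_1,x_2\in\mathbb R^n$. First-order method: it accesses $f$ and $A$ only through the oracle $\mathcal O(x,y)=(\nabla f(x),Ax,A^\top y)$. A first-order method $\mathcal M$ consists of an initial point $(x^{(0)},y^{(0)})\in X\times Y$ and a sequence of (deterministic) rules $\mathcal I_t$, $t\ge0$, with $$(x^{(t+1)},y^{(t+1)},\bar x^{(t+1)},\bar y^{(t+1)})=\mathcal I_t\big(\theta;\mathcal O(x^{(0)},y^{(0)}),\dots,\mathcal O(x^{(t)},y^{(t)})\big),$$ where $(x^{(t)},y^{(t)})\in X\times Y$ are inquiry points, $(\bar x^{(t)},\bar y^{(t)})\in X\times Y$ is the approximate solution output, and $\theta$ denotes all remaining information of the problem, which is fully known to $\mathcal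 M$: $X$, $Y$, $g$, $b$, the Lipschitz constant of $\nabla f$ and its associated norm (the initial point may depend on $\theta$). *)

theory Defs
  imports "HOL-Analysis.Analysis"
begin

definition gradient :: "(real ^ 'n \<Rightarrow> real) \<Rightarrow> real ^ 'n \<Rightarrow> real ^ 'n"
  where "gradient f x = (THE D. GDERIV f x :> D)"

definition strongly_convex :: "real \<Rightarrow> (real ^ 'n \<Rightarrow> real) \<Rightarrow> bool"
  where "strongly_convex \<mu> f \<longleftrightarrow>
    (\<forall>x1 x2. (gradient f x1 - gradient f x2) \<bullet> (x1 - x2) \<ge> \<mu> * (norm (x1 - x2))\<^sup>2)"

definition closed_convex_fun :: "('a::euclidean_space \<Rightarrow> real) \<Rightarrow> bool"
  where "closed_convex_fun h \<longleftrightarrow> convex_on UNIV h \<and> closed (epigraph UNIV h)"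

text \<open>
  The smallest Lipschitz constant of the gradient, with respect to the Euclidean norm.
\<close>

definition grad_lipschitz_const :: "(real ^ 'n \<Rightarrow> real) \<Rightarrow> real"
  where "grad_lipschitz_const f = Inf {L. L-lipschitz_on UNIV (gradient f)}"

definition spectral_norm :: "real ^ 'n ^ 'm \<Rightarrow> real"
  where "spectral_norm A = onorm (\<lambda>x. A *v x)"

record ('n::finite, 'm::finite) problem =
  X_set :: "(real ^ 'n) set"
  Y_set :: "(real ^ 'm) set"
  f_fun :: "real ^ 'n \<Rightarrow> real"
  g_fun :: "real ^ 'm \<Rightarrow> real"
  A_mat :: "real ^ 'n ^ 'm"
  b_vec :: "real ^ 'm"

definition bilinear_saddle_point_problem :: "('n::finite, 'm::finite) problem \<Rightarrow> bool"
  where "bilinear_saddle_point_problem P \<longleftrightarrow>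
    X_set P \<noteq> {} \<and> closed (X_set P) \<and> convex (X_set P) \<and>
    Y_set P \<noteq> {} \<and> closed (Y_set P) \<and> convex (Y_set P) \<and>
    closed_convex_fun (f_fun P) \<and> closed_convex_fun (g_fun P) \<and>
    (\<forall>x. f_fun P differentiable (at x)) \<and>
    (\<exists>L. L-lipschitz_on UNIV (gradient (f_fun P)))"

text \<open>
  The objectives are real-valued, so they have their intended meaning only where the supremum
  and the infimum are finite. This is so whenever \<open>X\<close> and \<open>Y\<close> are compact and nonempty: finite
  convex functions are continuous, and the supremum and infimum are attained.
\<close>

definition primal_objective ::
  "('n::finite, 'm::finite) problem \<Rightarrow> real ^ 'n \<Rightarrow> real"
  where "primal_objective P x =
    f_fun P x + (SUP y\<in>Y_set P. (A_mat P *v x - b_vec P) \<bullet> y - g_fun P y)"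

definition dual_objective ::
  "('n::finite, 'm::finite) problem \<Rightarrow> real ^ 'm \<Rightarrow> real"
  where "dual_objective P y =
    - g_fun P y + (INF x\<in>X_set P. (A_mat P *v x - b_vec P) \<bullet> y + f_fun P x)"

text \<open>
  What a first-order method knows about a problem without calling the oracle (the parameter
  \<open>\<theta>\<close>). The norm with respect to which the gradient is Lipschitz is part of that information;
  here it is always the Euclidean norm.
\<close>

record ('n::finite, 'm::finite) known_info =
  known_X :: "(real ^ 'n) set"
  known_Y :: "(real ^ 'm) set"
  known_g :: "real ^ 'm \<Rightarrow> real"
  known_b :: "real ^ 'm"
  known_L :: real
  known_norm :: "real ^ 'n \<Rightarrow> real"

definition known :: "('n::finite, 'm::finite) problem \<Rightarrow> ('n, 'm) known_info"
  where "known P =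
    \<lparr> known_X = X_set P, known_Y = Y_set P, known_g = g_fun P, known_b = b_vec P,
      known_L = grad_lipschitz_const (f_fun P), known_norm = norm \<rparr>"

type_synonym ('n, 'm) point = "(real ^ 'n) \<times> (real ^ 'm)"
type_synonym ('n, 'm) answer = "(real ^ 'n) \<times> (real ^ 'm) \<times> (real ^ 'n)"

definition first_order_oracle ::
  "('n::finite, 'm::finite) problem \<Rightarrow> ('n, 'm) point \<Rightarrow> ('n, 'm) answer"
  where "first_order_oracle P z =
    (gradient (f_fun P) (fst z), A_mat P *v fst z, transpose (A_mat P) *v snd z)"

text \<open>
  Rule number \<open>t\<close> maps the known information and the list of the first \<open>t + 1\<close> oracle answers to
  the pair of the next inquiry point and the next approximate solution.
\<close>

record ('n::finite, 'm::finite) scheme =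
  initial_point :: "('n, 'm) known_info \<Rightarrow> ('n, 'm) point"
  update_rule :: "nat \<Rightarrow> ('n, 'm) known_info \<Rightarrow> ('n, 'm) answer list
    \<Rightarrow> ('n, 'm) point \<times> ('n, 'm) point"

text \<open>The answers to the inquiries number \<open>0, \<dots>, t\<close>, in this order.\<close>

primrec history ::
  "('n::finite, 'm::finite) scheme \<Rightarrow> ('n, 'm) problem \<Rightarrow> nat \<Rightarrow> ('n, 'm) answer list"
  where
    "history M P 0 = [first_order_oracle P (initial_point M (known P))]"
  | "history M P (Suc t) = history M P t @
      [first_order_oracle P (fst (update_rule M t (known P) (history M P t)))]"

primrec inquiry ::
  "('n::finite, 'm::finite) scheme \<Rightarrow> ('n, 'm) problem \<Rightarrow> nat \<Rightarrow> ('n, 'm) point"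
  where
    "inquiry M P 0 = initial_point M (known P)"
  | "inquiry M P (Suc t) = fst (update_rule M t (known P) (history M P t))"

text \<open>
  The approximate solution number \<open>t\<close> is produced by rule number \<open>t - 1\<close>; it is meaningful only
  for \<open>t \<ge> 1\<close>.
\<close>

definition approx_solution ::
  "('n::finite, 'm::finite) scheme \<Rightarrow> ('n, 'm) problem \<Rightarrow> nat \<Rightarrow> ('n, 'm) point"
  where "approx_solution M P t =
    snd (update_rule M (t - 1) (known P) (history M P (t - 1)))"

lemma history_eq_map_inquiry:
  "history M P t = map (\<lambda>i. first_order_oracle P (inquiry M P i)) [0..<Suc t]"
  by (induction t) simp_all

text \<open>
  The feasibility of the points is required only along the runs of the method on actual problems.
\<close>

definition first_order_method :: "('n::finite, 'm::finite) scheme \<Rightarrow> bool"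
  where "first_order_method M \<longleftrightarrow>
    (\<forall>P. bilinear_saddle_point_problem P \<longrightarrow>
      (\<forall>t. inquiry M P t \<in> X_set P \<times> Y_set P) \<and>
      (\<forall>t\<ge>1. approx_solution M P t \<in> X_set P \<times> Y_set P))"

end

theory Submission
  imports Defs
begin

text \<open>
  The hard instances have \<open>f x = \<mu>/2 \<bar>x\<bar>\<^sup>2\<close>, \<open>g = 0\<close> and a matrix \<open>A\<close> that is bidiagonal in
  orthonormal systems \<open>u\<close>, \<open>v\<close>; the right-hand side \<open>b\<close> is a multiple of the first vector of the
  chain \<open>u\<^sub>1, v\<^sub>1, u\<^sub>2, v\<^sub>2, \<dots>\<close>.  A resisting adversary chooses \<open>u\<close> and \<open>v\<close> while the method runs: the
  vectors not yet used in an answer are replaced by vectors orthogonal to all inquiries made so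
  far, so that \<open>t\<close> answers involve only the vectors with index at most \<open>t\<close>, and the output
  \<open>x\<close> is orthogonal to \<open>v\<^sub>j\<close> for \<open>j > t\<close>.  The solution is the minimum norm solution of \<open>A x = b\<close>
  and has equal components along all the \<open>v\<^sub>j\<close>, which bounds its distance to \<open>x\<close> from below.  The
  bound on the duality gap follows because the primal objective grows quadratically around its
  minimizer.
\<close>

section \<open>Orthonormal systems\<close>

text \<open>Total functions let single vectors be replaced by function update; values above
  \<open>N\<close> are unconstrained. Index 0 counts, so there are \<open>N + 1\<close>
  vectors.\<close>

definition orthonormal_upto :: "nat \<Rightarrow> (nat \<Rightarrow> 'a::real_inner) \<Rightarrow> bool"
  where "orthonormal_upto N w \<longleftrightarrow> (\<forall>i\<le>N. \<forall>j\<le>N. w i \<bullet> w j = (if i = j then 1 else 0))"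

lemma orthonormal_uptoD:
  "orthonormal_upto N w \<Longrightarrow> i \<le> N \<Longrightarrow> j \<le> N \<Longrightarrow> w i \<bullet> w j = (if i = j then 1 else 0)"
  by (simp add: orthonormal_upto_def)

lemma orthonormal_upto_mono: "orthonormal_upto N w \<Longrightarrow> k \<le> N \<Longrightarrow> orthonormal_upto k w"
  by (auto simp: orthonormal_upto_def)

lemma inner_orthonormal_sum:
  assumes "orthonormal_upto N w" "I \<subseteq> {..N}" "i \<le> N"
  shows "w i \<bullet> (\<Sum>j\<in>I. c j *\<^sub>R w j) = (if i \<in> I then c i else 0)"
proof -
  have "finite I"
    using assms(2) finite_subset by blast
  have "w i \<bullet> (\<Sum>j\<in>I. c j *\<^sub>R w j) = (\<Sum>j\<in>I. if i = j then c j else 0)"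
    unfolding inner_sum_right
    using assms by (intro sum.cong) (auto simp: orthonormal_uptoD)
  then show ?thesis
    using \<open>finite I\<close> by (simp add: sum.delta')
qed

lemma norm_orthonormal_sum:
  assumes "orthonormal_upto N w" "I \<subseteq> {..N}"
  shows "(norm (\<Sum>j\<in>I. c j *\<^sub>R w j))\<^sup>2 = (\<Sum>j\<in>I. (c j)\<^sup>2)"
proof -
  have "(norm (\<Sum>j\<in>I. c j *\<^sub>R w j))\<^sup>2 = (\<Sum>i\<in>I. c i * (w i \<bullet> (\<Sum>j\<in>I. c j *\<^sub>R w j)))"
    by (simp add: power2_norm_eq_inner inner_sum_left)
  also have "\<dots> = (\<Sum>i\<in>I. (c i)\<^sup>2)"
    using assms by (intro sum.cong) (auto simp: inner_orthonormal_sum power2_eq_square subset_iff)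
  finally show ?thesis .
qed

lemma bessel_inequality:
  assumes "orthonormal_upto N w" "I \<subseteq> {..N}"
  shows "(\<Sum>j\<in>I. (w j \<bullet> x)\<^sup>2) \<le> (norm x)\<^sup>2"
proof -
  define p where "p = (\<Sum>j\<in>I. (w j \<bullet> x) *\<^sub>R w j)"
  have 1: "x \<bullet> p = (\<Sum>j\<in>I. (w j \<bullet> x)\<^sup>2)"
    by (simp add: p_def inner_sum_right power2_eq_square inner_commute)
  have 2: "(norm p)\<^sup>2 = (\<Sum>j\<in>I. (w j \<bullet> x)\<^sup>2)"
    unfolding p_def using assms by (rule norm_orthonormal_sum)
  have "0 \<le> (norm (x - p))\<^sup>2"
    by simp
  also have "\<dots> = (norm x)\<^sup>2 - 2 * (x \<bullet> p) + (norm p)\<^sup>2"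
    by (simp add: power2_norm_eq_inner inner_diff inner_commute)
  finally show ?thesis
    using 1 2 by simp
qed

lemma unit_vector_orthogonal_to:
  fixes S :: "'a::euclidean_space set"
  assumes "finite S" "card S < DIM('a)"
  obtains z where "norm z = 1" "\<And>s. s \<in> S \<Longrightarrow> z \<bullet> s = 0"
proof -
  have "dim (span S) < DIM('a)"
    using dim_le_card'[OF assms(1)] assms(2) by simp
  then obtain y where y: "y \<noteq> 0" "\<And>s. s \<in> span (span S) \<Longrightarrow> orthogonal y s"
    using orthogonal_to_subspace_exists[of "span S"] by auto
  show thesis
  proof
    show "norm (sgn y) = 1"
      using y(1) by (simp add: norm_sgn)
    show "sgn y \<bullet> s = 0" if "s \<in> S" for s
      using y(2)[of s] that by (simp add: sgn_div_norm orthogonal_def span_base)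
  qed
qed

text \<open>This is one move of the adversary: keep the vectors already revealed and rebuild the
  others away from the inquiries in \<open>S\<close>. They are added one at a time; each must avoid
  \<open>S\<close> and all earlier vectors, and the dimension leaves room for that.\<close>

lemma orthonormal_extension:
  fixes w :: "nat \<Rightarrow> 'a::euclidean_space"
  assumes "orthonormal_upto k w" "k \<le> N" "finite S" "N + card S < DIM('a)"
  shows "\<exists>w'. orthonormal_upto N w' \<and> (\<forall>j\<le>k. w' j = w j) \<and>
    (\<forall>j. k < j \<and> j \<le> N \<longrightarrow> (\<forall>s\<in>S. w' j \<bullet> s = 0))"
  using assms(2,4)
proof (induction N rule: dec_induct)
  case base
  then show ?case
    using assms(1) by auto
next
  case (step N)
  then obtain w' where w': "orthonormal_upto N w'" "\<forall>j\<le>k. w' j = w j"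
    "\<forall>j. k < j \<and> j \<le> N \<longrightarrow> (\<forall>s\<in>S. w' j \<bullet> s = 0)"
    by auto
  have "card (S \<union> w' ` {..N}) \<le> card S + Suc N"
    using card_Un_le[of S "w' ` {..N}"] card_image_le[of "{..N}" w'] by simp
  then have "card (S \<union> w' ` {..N}) < DIM('a)"
    using step.prems by simp
  then obtain z where z: "norm z = 1" "\<And>s. s \<in> S \<union> w' ` {..N} \<Longrightarrow> z \<bullet> s = 0"
    using unit_vector_orthogonal_to[of "S \<union> w' ` {..N}"] \<open>finite S\<close> by auto
  have zz: "z \<bullet> z = 1"
    using z(1) by (simp add: norm_eq_1)
  have zw: "z \<bullet> w' j = 0" "w' j \<bullet> z = 0" if "j \<le> N" for j
    using z(2)[of "w' j"] that by (auto simp: inner_commute)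
  have "orthonormal_upto (Suc N) (w'(Suc N := z))"
    using w'(1) zz zw by (auto simp: orthonormal_upto_def le_Suc_eq)
  moreover have "\<forall>j\<le>k. (w'(Suc N := z)) j = w j"
    using w'(2) step.hyps by auto
  moreover have "\<forall>j. k < j \<and> j \<le> Suc N \<longrightarrow> (\<forall>s\<in>S. (w'(Suc N := z)) j \<bullet> s = 0)"
    using w'(3) z(2) by (auto simp: le_Suc_eq)
  ultimately show ?case
    by blast
qed

lemma orthonormal_exists:
  assumes "N < DIM('a)"
  obtains w :: "nat \<Rightarrow> 'a::euclidean_space" where "orthonormal_upto N w"
proof -
  obtain e :: 'a where "norm e = 1"
    using vector_choose_size[of 1] by auto
  then have "orthonormal_upto 0 (\<lambda>_. e)"
    by (simp add: orthonormal_upto_def norm_eq_1)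
  then show thesis
    using orthonormal_extension[of 0 "\<lambda>_. e" N "{}"] assms that by auto
qed

section \<open>The bidiagonal map\<close>

text \<open>The pair \<open>u\<^sub>0\<close>, \<open>v\<^sub>0\<close> lies outside the chain; it makes the norm exactly \<open>L\<close>.\<close>

definition chain_map ::
  "real \<Rightarrow> nat \<Rightarrow> (nat \<Rightarrow> 'b::euclidean_space) \<Rightarrow> (nat \<Rightarrow> 'a::euclidean_space) \<Rightarrow> 'a \<Rightarrow> 'b"
  where "chain_map L N u v x = (L * (v 0 \<bullet> x)) *\<^sub>R u 0 +
    (L / 2) *\<^sub>R ((\<Sum>j=1..N. (v j \<bullet> x) *\<^sub>R u j) - (\<Sum>j=1..<N. (v j \<bullet> x) *\<^sub>R u (Suc j)))"

text \<open>The adjoint of \<open>chain_map\<close>, written out in coordinates; see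
  \<open>inner_chain_map\<close>.\<close>

definition cochain_map ::
  "real \<Rightarrow> nat \<Rightarrow> (nat \<Rightarrow> 'b::euclidean_space) \<Rightarrow> (nat \<Rightarrow> 'a::euclidean_space) \<Rightarrow> 'b \<Rightarrow> 'a"
  where "cochain_map L N u v y = (L * (u 0 \<bullet> y)) *\<^sub>R v 0 +
    (L / 2) *\<^sub>R ((\<Sum>j=1..N. (u j \<bullet> y) *\<^sub>R v j) - (\<Sum>j=1..<N. (u (Suc j) \<bullet> y) *\<^sub>R v j))"

lemma linear_chain_map: "linear (chain_map L N u v)"
proof (rule linearI)
  show "chain_map L N u v (x + y) = chain_map L N u v x + chain_map L N u v y" for x y
    by (simp add: chain_map_def inner_add_right sum.distrib algebra_simps)
  show "chain_map L N u v (c *\<^sub>R x) = c *\<^sub>R chain_map L N u v x" for c x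
    by (simp add: chain_map_def scaleR_sum_right algebra_simps)
qed

lemma inner_chain_map: "chain_map L N u v x \<bullet> y = x \<bullet> cochain_map L N u v y"
  by (simp add: chain_map_def cochain_map_def inner_add_left inner_add_right inner_diff_left
      inner_diff_right inner_sum_left inner_sum_right inner_commute mult_ac)

lemma matrix_chain_map:
  fixes u :: "nat \<Rightarrow> real ^ 'm" and v :: "nat \<Rightarrow> real ^ 'n"
  shows "matrix (chain_map L N u v) *v x = chain_map L N u v x"
    and "transpose (matrix (chain_map L N u v)) *v y = cochain_map L N u v y"
proof -
  have A: "(*v) (matrix (chain_map L N u v)) = chain_map L N u v"
    by (rule ext) (rule matrix_works, simp add: linear_matrix_vector_mul_eq linear_chain_map)
  then show "matrix (chain_map L N u v) *v x = chain_map L N u v x"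
    by simp
  have "adjoint (chain_map L N u v) = cochain_map L N u v"
    by (rule adjoint_unique) (simp add: inner_chain_map)
  then show "transpose (matrix (chain_map L N u v)) *v y = cochain_map L N u v y"
    using adjoint_matrix[of "matrix (chain_map L N u v)"] A by simp
qed

text \<open>An input without components beyond \<open>v i\<close> activates only columns up to
  \<open>i\<close>, and column \<open>j\<close> reaches no further than \<open>u (Suc j)\<close>.
  Replacing later vectors therefore goes unnoticed.\<close>

lemma chain_map_cong:
  assumes "\<And>j. j \<le> i \<Longrightarrow> v' j = v j" "\<And>j. j \<le> Suc i \<Longrightarrow> u' j = u j"
    and "\<And>j. i < j \<Longrightarrow> j \<le> N \<Longrightarrow> v j \<bullet> x = 0" "\<And>j. i < j \<Longrightarrow> j \<le> N \<Longrightarrow> v' j \<bullet> x = 0"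
  shows "chain_map L N u' v' x = chain_map L N u v x"
proof -
  have "(v' j \<bullet> x) *\<^sub>R u' j = (v j \<bullet> x) *\<^sub>R u j \<and>
      (v' j \<bullet> x) *\<^sub>R u' (Suc j) = (v j \<bullet> x) *\<^sub>R u (Suc j)" if "j \<le> N" for j
    using assms that by (cases "j \<le> i") auto
  then show ?thesis
    using assms(1,2)[of 0] by (simp add: chain_map_def)
qed

text \<open>The coefficient of \<open>v j\<close> involves only \<open>u j\<close> and
  \<open>u (Suc j)\<close>, so it vanishes for \<open>j > Suc i\<close>.\<close>

lemma cochain_map_cong:
  assumes "\<And>j. j \<le> Suc i \<Longrightarrow> v' j = v j" "\<And>j. j \<le> Suc i \<Longrightarrow> u' j = u j"
    and "\<And>j. Suc i < j \<Longrightarrow> j \<le> N \<Longrightarrow> u j \<bullet> y = 0" "\<And>j. Suc i < j \<Longrightarrow> j \<le> N \<Longrightarrow> u' j \<bullet> y = 0"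
  shows "cochain_map L N u' v' y = cochain_map L N u v y"
proof -
  have 1: "(u' j \<bullet> y) *\<^sub>R v' j = (u j \<bullet> y) *\<^sub>R v j" if "j \<le> N" for j
    using assms that by (cases "j \<le> Suc i") auto
  have 2: "(u' (Suc j) \<bullet> y) *\<^sub>R v' j = (u (Suc j) \<bullet> y) *\<^sub>R v j" if "j < N" for j
    using assms that by (cases "j \<le> i") auto
  show ?thesis
    using 1 2 assms(1,2)[of 0] by (simp add: cochain_map_def)
qed

text \<open>The chain part is a difference of two partial isometries applied to the coefficients of
  \<open>x\<close>, hence has norm at most 2 before scaling; the factor \<open>L / 2\<close>
  compensates. The part along \<open>u 0\<close> is orthogonal to it.\<close>

lemma norm_chain_map_le:
  assumes u: "orthonormal_upto N u" and v: "orthonormal_upto N v"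
  shows "norm (chain_map L N u v x) \<le> \<bar>L\<bar> * norm x"
proof -
  define p where "p = (\<Sum>j=1..N. (v j \<bullet> x) *\<^sub>R u j)"
  define q where "q = (\<Sum>j=1..<N. (v j \<bullet> x) *\<^sub>R u (Suc j))"
  define s where "s = (\<Sum>j=1..N. (v j \<bullet> x)\<^sup>2)"
  have q_eq: "q = (\<Sum>j=2..N. (v (j - 1) \<bullet> x) *\<^sub>R u j)"
    unfolding q_def by (rule sum.reindex_bij_witness[of _ "\<lambda>j. j - 1" Suc]) auto
  have p2: "(norm p)\<^sup>2 = s"
    unfolding p_def s_def using norm_orthonormal_sum[OF u, of "{1..N}"] by auto
  have "(norm q)\<^sup>2 = (\<Sum>j=2..N. (v (j - 1) \<bullet> x)\<^sup>2)"
    unfolding q_eq using norm_orthonormal_sum[OF u, of "{2..N}"] by auto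
  also have "\<dots> = (\<Sum>j=1..<N. (v j \<bullet> x)\<^sup>2)"
    by (rule sum.reindex_bij_witness[of _ Suc "\<lambda>j. j - 1"]) auto
  also have "\<dots> \<le> s"
    unfolding s_def by (rule sum_mono2) auto
  finally have q2: "(norm q)\<^sup>2 \<le> s" .
  have "u 0 \<bullet> p = 0"
    unfolding p_def using inner_orthonormal_sum[OF u, of "{1..N}" 0] by auto
  moreover have "u 0 \<bullet> q = 0"
    unfolding q_eq using inner_orthonormal_sum[OF u, of "{2..N}" 0] by auto
  ultimately have "orthogonal ((L * (v 0 \<bullet> x)) *\<^sub>R u 0) ((L / 2) *\<^sub>R (p - q))"
    by (simp add: orthogonal_def inner_diff_right)
  moreover have "norm (u 0) = 1"
    using orthonormal_uptoD[OF u, of 0 0] by (simp add: norm_eq_1)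
  ultimately have "(norm (chain_map L N u v x))\<^sup>2 = L\<^sup>2 * (v 0 \<bullet> x)\<^sup>2 + L\<^sup>2 / 4 * (norm (p - q))\<^sup>2"
    unfolding chain_map_def p_def[symmetric] q_def[symmetric]
    by (simp add: norm_add_Pythagorean power_mult_distrib power_divide)
  \<comment> \<open>Parallelogram law, with the square of \<open>norm (p + q)\<close>
    dropped.\<close>
  also have "(norm (p - q))\<^sup>2 \<le> 2 * (norm p)\<^sup>2 + 2 * (norm q)\<^sup>2"
    using zero_le_power2[of "norm (p + q)"]
    by (simp add: power2_norm_eq_inner inner_diff inner_add inner_commute)
  then have "(norm (p - q))\<^sup>2 \<le> 4 * s"
    using p2 q2 by simp
  then have "L\<^sup>2 / 4 * (norm (p - q))\<^sup>2 \<le> L\<^sup>2 / 4 * (4 * s)"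
    by (intro mult_left_mono) auto
  then have "L\<^sup>2 * (v 0 \<bullet> x)\<^sup>2 + L\<^sup>2 / 4 * (norm (p - q))\<^sup>2 \<le> L\<^sup>2 * ((v 0 \<bullet> x)\<^sup>2 + s)"
    by (simp add: algebra_simps)
  also have "(v 0 \<bullet> x)\<^sup>2 + s = (\<Sum>j\<in>{..N}. (v j \<bullet> x)\<^sup>2)"
    unfolding s_def by (simp add: atMost_atLeast0 sum.atLeast_Suc_atMost)
  also have "\<dots> \<le> (norm x)\<^sup>2"
    using bessel_inequality[OF v, of "{..N}"] by simp
  finally have "(norm (chain_map L N u v x))\<^sup>2 \<le> (\<bar>L\<bar> * norm x)\<^sup>2"
    by (simp add: power_mult_distrib mult_left_mono)
  then show ?thesis
    by (rule power2_le_imp_le) simp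
qed

text \<open>The bound is attained at \<open>v 0\<close>, which the chain part annihilates.\<close>

lemma onorm_chain_map:
  assumes u: "orthonormal_upto N u" and v: "orthonormal_upto N v" and "0 \<le> L"
  shows "onorm (chain_map L N u v) = L"
proof (rule antisym)
  show "onorm (chain_map L N u v) \<le> L"
    using norm_chain_map_le[OF u v, of L] \<open>0 \<le> L\<close> by (intro onorm_le) simp
  have v0: "v j \<bullet> v 0 = 0" if "1 \<le> j" "j \<le> N" for j
    using orthonormal_uptoD[OF v, of j 0] that by simp
  have unit: "u 0 \<bullet> u 0 = 1" "v 0 \<bullet> v 0 = 1"
    using orthonormal_uptoD[OF u, of 0 0] orthonormal_uptoD[OF v, of 0 0] by auto
  have "chain_map L N u v (v 0) = L *\<^sub>R u 0"
    by (simp add: chain_map_def v0 unit)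
  then have "norm (chain_map L N u v (v 0)) = L" "norm (v 0) = 1"
    using unit \<open>0 \<le> L\<close> by (simp_all add: norm_eq_1[symmetric])
  then show "L \<le> onorm (chain_map L N u v)"
    using onorm[OF linear_conv_bounded_linear[THEN iffD1, OF linear_chain_map[of L N u v]], of "v 0"]
    by simp
qed

text \<open>With constant coefficients the two sums telescope and only \<open>u 1\<close> survives.
  This makes the multiple of \<open>u 1\<close> chosen as \<open>b\<close> equal to the image of the
  solution.\<close>

lemma chain_map_sum:
  assumes v: "orthonormal_upto N v" and "1 \<le> N"
  shows "chain_map L N u v (c *\<^sub>R (\<Sum>j=1..N. v j)) = (L * c / 2) *\<^sub>R u 1"
proof -
  have c: "v i \<bullet> (c *\<^sub>R (\<Sum>j=1..N. v j)) = (if 1 \<le> i then c else 0)" if "i \<le> N" for i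
    using inner_orthonormal_sum[OF v, of "{1..N}" i "\<lambda>_. 1"] that by auto
  have "(\<Sum>j=1..<N. u (Suc j)) = (\<Sum>j=2..N. u j)"
    by (rule sum.reindex_bij_witness[of _ "\<lambda>j. j - 1" Suc]) auto
  moreover have "(\<Sum>j=1..N. u j) = u 1 + (\<Sum>j=2..N. u j)"
    using \<open>1 \<le> N\<close> by (simp add: sum.atLeast_Suc_atMost numeral_2_eq_2)
  ultimately have "(\<Sum>j=1..N. u j) - (\<Sum>j=1..<N. u (Suc j)) = u 1"
    by simp
  moreover have "chain_map L N u v (c *\<^sub>R (\<Sum>j=1..N. v j)) =
      (L / 2) *\<^sub>R c *\<^sub>R ((\<Sum>j=1..N. u j) - (\<Sum>j=1..<N. u (Suc j)))"
  proof -
    have "(\<Sum>j=1..N. (v j \<bullet> (c *\<^sub>R (\<Sum>j=1..N. v j))) *\<^sub>R u j) = c *\<^sub>R (\<Sum>j=1..N. u j)"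
      unfolding scaleR_sum_right[of c u] by (intro sum.cong refl) (subst c, auto)
    moreover have "(\<Sum>j=1..<N. (v j \<bullet> (c *\<^sub>R (\<Sum>j=1..N. v j))) *\<^sub>R u (Suc j)) =
        c *\<^sub>R (\<Sum>j=1..<N. u (Suc j))"
      unfolding scaleR_sum_right[of c "\<lambda>j. u (Suc j)"] by (intro sum.cong refl) (subst c, auto)
    ultimately show ?thesis
      unfolding chain_map_def c[OF le0] by (simp add: scaleR_diff_right)
  qed
  ultimately show ?thesis
    by simp
qed

text \<open>The coefficients drop by one at each step and end at one, so every \<open>v j\<close>
  with \<open>j\<close> from 1 to \<open>N\<close> gets the same weight. This provides the dual half
  of the saddle point.\<close>

lemma cochain_map_sum:
  assumes u: "orthonormal_upto N u"
  shows "cochain_map L N u v (\<Sum>j=1..N. (real N + 1 - real j) *\<^sub>R u j) =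
    (L / 2) *\<^sub>R (\<Sum>j=1..N. v j)"
proof -
  define y where "y = (\<Sum>j=1..N. (real N + 1 - real j) *\<^sub>R u j)"
  have c: "u i \<bullet> y = (if 1 \<le> i then real N + 1 - real i else 0)" if "i \<le> N" for i
    unfolding y_def
    using inner_orthonormal_sum[OF u, of "{1..N}" i] that by auto
  have "(\<Sum>j=1..<N. (u (Suc j) \<bullet> y) *\<^sub>R v j) = (\<Sum>j=1..<N. (real N - real j) *\<^sub>R v j)"
    by (simp add: c)
  \<comment> \<open>The added term \<open>j = N\<close> has coefficient 0.\<close>
  also have "\<dots> = (\<Sum>j=1..N. (real N - real j) *\<^sub>R v j)"
    by (rule sum.mono_neutral_left) auto
  finally have "(\<Sum>j=1..N. (u j \<bullet> y) *\<^sub>R v j) - (\<Sum>j=1..<N. (u (Suc j) \<bullet> y) *\<^sub>R v j) =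
      (\<Sum>j=1..N. (real N + 1 - real j) *\<^sub>R v j) - (\<Sum>j=1..N. (real N - real j) *\<^sub>R v j)"
    by (simp add: c)
  also have "\<dots> = (\<Sum>j=1..N. v j)"
    by (simp add: sum_subtractf[symmetric] scaleR_diff_left[symmetric])
  finally show ?thesis
    unfolding cochain_map_def y_def[symmetric] using c[of 0] by simp
qed

section \<open>The resisting adversary\<close>

text \<open>An abstract run: \<open>F\<close> maps the answers so far to the next inquiry. Starting
  from the empty list lets one function cover the initial point and all rules, since the length of
  the list tells the round.\<close>

primrec answers :: "('a list \<Rightarrow> 'q) \<Rightarrow> ('q \<Rightarrow> 'a) \<Rightarrow> nat \<Rightarrow> 'a list"
  where
    "answers F orc 0 = []"
  | "answers F orc (Suc k) = answers F orc k @ [orc (F (answers F orc k))]"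

lemma length_answers [simp]: "length (answers F orc k) = k"
  by (induction k) auto

lemma answers_eq_Nil_iff [simp]: "answers F orc k = [] \<longleftrightarrow> k = 0"
  by (cases k) auto

lemma answers_cong:
  assumes "\<And>i. i < k \<Longrightarrow> orc' (F (answers F orc i)) = orc (F (answers F orc i))" "i \<le> k"
  shows "answers F orc' i = answers F orc i"
  using assms(2)
proof (induction i)
  case (Suc i)
  then show ?case
    using assms(1)[of i] by simp
qed simp

definition chain_oracle ::
  "real \<Rightarrow> real \<Rightarrow> nat \<Rightarrow> (nat \<Rightarrow> 'b::euclidean_space) \<Rightarrow> (nat \<Rightarrow> 'a::euclidean_space) \<Rightarrow>
    'a \<times> 'b \<Rightarrow> 'a \<times> 'b \<times> 'a"
  where "chain_oracle \<mu> L N u v z =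
    (\<mu> *\<^sub>R fst z, chain_map L N u v (fst z), cochain_map L N u v (snd z))"

text \<open>The orthogonality concerns the run against the final \<open>u\<close> and
  \<open>v\<close>, so each replacement must leave all earlier answers intact; the two congruence
  lemmas ensure this. The vector \<open>u 1\<close> stays fixed because it determines
  \<open>b\<close>, which the method knows.\<close>

lemma resisting_answers:
  fixes F :: "('a \<times> 'b \<times> 'a) list \<Rightarrow> 'a::euclidean_space \<times> 'b::euclidean_space"
    and u0 :: "nat \<Rightarrow> 'b" and v0 :: "nat \<Rightarrow> 'a"
  assumes u0: "orthonormal_upto N u0" and v0: "orthonormal_upto N v0"
    and "N + k < DIM('a)" "N + k < DIM('b)" "k \<le> N"
  shows "\<exists>u v. orthonormal_upto N u \<and> orthonormal_upto N v \<and> u 1 = u0 1 \<and>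
    (\<forall>i<k. \<forall>j\<le>N.
      (i < j \<longrightarrow> v j \<bullet> fst (F (answers F (chain_oracle \<mu> L N u v) i)) = 0) \<and>
      (Suc i < j \<longrightarrow> u j \<bullet> snd (F (answers F (chain_oracle \<mu> L N u v) i)) = 0))"
  using assms(3-5)
proof (induction k)
  case 0
  then show ?case
    using u0 v0 by blast
next
  case (Suc k)
  then obtain u v where u: "orthonormal_upto N u" and v: "orthonormal_upto N v" and u1: "u 1 = u0 1"
    and orth: "\<And>i j. i < k \<Longrightarrow> j \<le> N \<Longrightarrow>
      (i < j \<longrightarrow> v j \<bullet> fst (F (answers F (chain_oracle \<mu> L N u v) i)) = 0) \<and>
      (Suc i < j \<longrightarrow> u j \<bullet> snd (F (answers F (chain_oracle \<mu> L N u v) i)) = 0)"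
    by (metis Suc_lessD Suc_leD add_Suc_right)
  \<comment> \<open>Inquiry \<open>k\<close> is already determined by the first \<open>k\<close>
    answers, so the new vectors can be made orthogonal to it as well.\<close>
  define q where "q i = F (answers F (chain_oracle \<mu> L N u v) i)" for i
  have card: "card ((\<lambda>i. fst (q i)) ` {..k}) \<le> Suc k" "card ((\<lambda>i. snd (q i)) ` {..k}) \<le> Suc k"
    using card_image_le[of "{..k}" "\<lambda>i. fst (q i)"] card_image_le[of "{..k}" "\<lambda>i. snd (q i)"]
    by auto
  obtain v' where v': "orthonormal_upto N v'" "\<forall>j\<le>k. v' j = v j"
    "\<forall>j. k < j \<and> j \<le> N \<longrightarrow> (\<forall>s\<in>(\<lambda>i. fst (q i)) ` {..k}. v' j \<bullet> s = 0)"
    using orthonormal_extension[of k v N "(\<lambda>i. fst (q i)) ` {..k}"]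
      orthonormal_upto_mono[OF v, of k] Suc.prems card by fastforce
  \<comment> \<open>One more vector is kept than for \<open>v\<close>; hence \<open>u 1\<close>
    survives even the first round, \<open>k = 0\<close>.\<close>
  obtain u' where u': "orthonormal_upto N u'" "\<forall>j\<le>Suc k. u' j = u j"
    "\<forall>j. Suc k < j \<and> j \<le> N \<longrightarrow> (\<forall>s\<in>(\<lambda>i. snd (q i)) ` {..k}. u' j \<bullet> s = 0)"
    using orthonormal_extension[of "Suc k" u N "(\<lambda>i. snd (q i)) ` {..k}"]
      orthonormal_upto_mono[OF u, of "Suc k"] Suc.prems card by fastforce
  have orthv: "v' j \<bullet> fst (q i) = 0" if "i \<le> k" "i < j" "j \<le> N" for i j
  proof (cases "j \<le> k")
    case True
    then show ?thesis
      using orth[of i j] v'(2) that by (simp add: q_def)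
  next
    case False
    then show ?thesis
      using v'(3) that by auto
  qed
  have orthu: "u' j \<bullet> snd (q i) = 0" if "i \<le> k" "Suc i < j" "j \<le> N" for i j
  proof (cases "j \<le> Suc k")
    case True
    then show ?thesis
      using orth[of i j] u'(2) that by (simp add: q_def)
  next
    case False
    then show ?thesis
      using u'(3) that by auto
  qed
  have same: "chain_oracle \<mu> L N u' v' (q i) = chain_oracle \<mu> L N u v (q i)" if "i < k" for i
  proof -
    have "chain_map L N u' v' (fst (q i)) = chain_map L N u v (fst (q i))"
      using orthv orth u'(2) v'(2) that by (intro chain_map_cong[of i]) (auto simp: q_def)
    moreover have "cochain_map L N u' v' (snd (q i)) = cochain_map L N u v (snd (q i))"
      using orthu orth u'(2) v'(2) that by (intro cochain_map_cong[of i]) (auto simp: q_def)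
    ultimately show ?thesis
      by (simp add: chain_oracle_def)
  qed
  \<comment> \<open>Both oracles agree on the inquiries below \<open>k\<close>, so the method, being
    deterministic, also makes the same inquiry \<open>k\<close>.\<close>
  have "answers F (chain_oracle \<mu> L N u' v') i = answers F (chain_oracle \<mu> L N u v) i"
    if "i \<le> k" for i
    using same that by (intro answers_cong[of k]) (auto simp: q_def)
  then have "F (answers F (chain_oracle \<mu> L N u' v') i) = q i" if "i \<le> k" for i
    using that by (simp add: q_def)
  then show ?case
    using u'(1,2) v'(1) u1 orthu orthv by (intro exI[of _ u'] exI[of _ v']) (simp add: less_Suc_eq_le)
qed

section \<open>The quadratic instances\<close>

definition quadratic_problem ::
  "real \<Rightarrow> real \<Rightarrow> real \<Rightarrow> real ^ 'n ^ 'm \<Rightarrow> real ^ 'm \<Rightarrow> ('n::finite, 'm::finite) problem"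
  where "quadratic_problem \<mu> R_X R_Y A b =
    \<lparr> X_set = cball 0 R_X, Y_set = cball 0 R_Y, f_fun = \<lambda>x. \<mu> / 2 * (norm x)\<^sup>2,
      g_fun = \<lambda>_. 0, A_mat = A, b_vec = b \<rparr>"

lemma quadratic_problem_simps [simp]:
  "X_set (quadratic_problem \<mu> R_X R_Y A b) = cball 0 R_X"
  "Y_set (quadratic_problem \<mu> R_X R_Y A b) = cball 0 R_Y"
  "f_fun (quadratic_problem \<mu> R_X R_Y A b) = (\<lambda>x. \<mu> / 2 * (norm x)\<^sup>2)"
  "g_fun (quadratic_problem \<mu> R_X R_Y A b) = (\<lambda>_. 0)"
  "A_mat (quadratic_problem \<mu> R_X R_Y A b) = A"
  "b_vec (quadratic_problem \<mu> R_X R_Y A b) = b"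
  by (simp_all add: quadratic_problem_def)

text \<open>The matrix is hidden from the method, so it may be chosen after the known information is
  fixed.\<close>

lemma known_quadratic_problem:
  "known (quadratic_problem \<mu> R_X R_Y A b) = known (quadratic_problem \<mu> R_X R_Y A' b)"
  by (simp add: known_def)

section \<open>Gradient and convexity of the quadratic objective\<close>

lemma GDERIV_quadratic:
  fixes x :: "'a::real_inner"
  shows "GDERIV (\<lambda>x. \<mu> / 2 * (norm x)\<^sup>2) x :> \<mu> *\<^sub>R x"
  unfolding gderiv_def power2_norm_eq_inner
  by (auto intro!: derivative_eq_intros simp: fun_eq_iff inner_commute)

lemma gradient_quadratic: "gradient (\<lambda>x. \<mu> / 2 * (norm x)\<^sup>2) x = \<mu> *\<^sub>R x"
  unfolding gradient_def
proof (rule the_equality)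
  show "GDERIV (\<lambda>x. \<mu> / 2 * (norm x)\<^sup>2) x :> \<mu> *\<^sub>R x"
    by (rule GDERIV_quadratic)
  fix D
  assume "GDERIV (\<lambda>x. \<mu> / 2 * (norm x)\<^sup>2) x :> D"
  then have "(\<lambda>h. h \<bullet> D) = (\<lambda>h. h \<bullet> (\<mu> *\<^sub>R x))"
    using GDERIV_quadratic[of \<mu> x] has_derivative_unique unfolding gderiv_def by blast
  then show "D = \<mu> *\<^sub>R x"
    by (metis vector_eq_ldot)
qed

lemma closed_convex_fun_continuous:
  assumes "convex_on UNIV h" "continuous_on UNIV h"
  shows "closed_convex_fun h"
proof -
  have "closed {p. h (fst p) \<le> snd p}"
    by (intro closed_Collect_le continuous_intros continuous_on_compose2[OF assms(2)]) auto
  moreover have "epigraph UNIV h = {p. h (fst p) \<le> snd p}"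
    by (auto simp: epigraph_def)
  ultimately show ?thesis
    using assms(1) by (simp add: closed_convex_fun_def)
qed

lemma convex_on_quadratic:
  fixes \<mu> :: real
  assumes "0 \<le> \<mu>"
  shows "convex_on UNIV (\<lambda>x::'a::real_inner. \<mu> / 2 * (norm x)\<^sup>2)"
proof -
  have "convex_on UNIV (\<lambda>x::'a. (norm x)\<^sup>2)"
  proof (rule convex_onI)
    fix s :: real and x y :: 'a
    assume s: "0 < s" "s < 1"
    \<comment> \<open>The convexity defect of the squared norm in closed form.\<close>
    have "(1 - s) * (norm x)\<^sup>2 + s * (norm y)\<^sup>2 - (norm ((1 - s) *\<^sub>R x + s *\<^sub>R y))\<^sup>2 =
        s * (1 - s) * (norm (x - y))\<^sup>2"
      unfolding power2_norm_eq_inner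
      by (simp add: inner_add inner_diff inner_commute algebra_simps)
    moreover have "0 \<le> s * (1 - s) * (norm (x - y))\<^sup>2"
      using s by simp
    ultimately show "(norm ((1 - s) *\<^sub>R x + s *\<^sub>R y))\<^sup>2 \<le> (1 - s) * (norm x)\<^sup>2 + s * (norm y)\<^sup>2"
      by linarith
  qed simp
  then show ?thesis
    using assms by (intro convex_on_cmul) auto
qed

lemma bilinear_quadratic_problem:
  assumes "0 \<le> \<mu>" "0 \<le> R_X" "0 \<le> R_Y"
  shows "bilinear_saddle_point_problem (quadratic_problem \<mu> R_X R_Y A b)"
proof -
  have "closed_convex_fun (\<lambda>x::real ^ 'k. \<mu> / 2 * (norm x)\<^sup>2)"
    by (intro closed_convex_fun_continuous convex_on_quadratic assms continuous_intros)
  moreover have "closed_convex_fun (\<lambda>_::real ^ 'k. 0)"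
    by (intro closed_convex_fun_continuous continuous_intros) (simp add: convex_on_const)
  moreover have "(\<lambda>x::real ^ 'k. \<mu> / 2 * (norm x)\<^sup>2) differentiable (at x)" for x
    using GDERIV_quadratic[of \<mu> x] unfolding gderiv_def differentiable_def by blast
  moreover have "\<mu>-lipschitz_on UNIV (gradient (\<lambda>x::real ^ 'k. \<mu> / 2 * (norm x)\<^sup>2))"
    unfolding gradient_quadratic[abs_def] using assms(1)
    by (intro lipschitz_onI) (simp_all add: dist_norm flip: scaleR_diff_right)
  ultimately show ?thesis
    using assms by (auto simp: bilinear_saddle_point_problem_def)
qed

lemma strongly_convex_quadratic: "strongly_convex \<mu> (\<lambda>x. \<mu> / 2 * (norm x)\<^sup>2)"
  unfolding strongly_convex_def gradient_quadratic scaleR_diff_right[symmetric]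
  by (simp add: power2_norm_eq_inner)

section \<open>Saddle points and the duality gap\<close>

text \<open>The conditions on \<open>x\<close> and \<open>y\<close> say that \<open>(x, y)\<close> is a saddle point.\<close>

locale quadratic_saddle =
  fixes \<mu> R_X R_Y :: real and A :: "real ^ 'n ^ 'm" and b :: "real ^ 'm"
    and x_hat :: "real ^ 'n" and y_hat :: "real ^ 'm"
  assumes pos: "0 < \<mu>"
    and x_mem: "norm x_hat \<le> R_X" and y_mem: "norm y_hat \<le> R_Y"
    and primal_feasible: "A *v x_hat = b"
    and stationary: "transpose A *v y_hat = - (\<mu> *\<^sub>R x_hat)"
begin

abbreviation "P \<equiv> quadratic_problem \<mu> R_X R_Y A b"

lemma R_nonneg: "0 \<le> R_X" "0 \<le> R_Y"
  using x_mem y_mem norm_ge_zero order_trans by blast+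

lemma primal_objective_at_solution: "primal_objective P x_hat = \<mu> / 2 * (norm x_hat)\<^sup>2"
  using R_nonneg by (simp add: primal_objective_def primal_feasible)

text \<open>Bounding the supremum below by its value at \<open>y_hat\<close> and using stationarity
  leaves a quadratic in \<open>x\<close>; completing the square around \<open>x_hat\<close> gives
  the claim.\<close>

lemma quadratic_growth:
  "primal_objective P x \<ge> primal_objective P x_hat + \<mu> / 2 * (norm (x - x_hat))\<^sup>2"
proof -
  define r where "r = A *v x - b"
  have "bdd_above ((\<lambda>y. r \<bullet> y) ` cball 0 R_Y)"
    by (intro bounded_imp_bdd_above compact_imp_bounded compact_continuous_image
        continuous_intros compact_cball)
  then have "r \<bullet> y_hat \<le> (SUP y\<in>cball 0 R_Y. r \<bullet> y)"
    using y_mem by (intro cSUP_upper) auto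
  then have "primal_objective P x \<ge> \<mu> / 2 * (norm x)\<^sup>2 + r \<bullet> y_hat"
    by (simp add: primal_objective_def r_def)
  moreover have "r \<bullet> y_hat = (x - x_hat) \<bullet> (transpose A *v y_hat)"
    unfolding r_def primal_feasible[symmetric] matrix_vector_mult_diff_distrib[symmetric]
    by (metis dot_lmul_matrix inner_commute transpose_matrix_vector)
  ultimately show ?thesis
    unfolding primal_objective_at_solution stationary power2_norm_eq_inner
    by (simp add: inner_diff inner_commute field_simps)
qed

text \<open>Evaluating the infimum at \<open>x_hat\<close> suffices, since the residual vanishes
  there.\<close>

lemma weak_duality: "dual_objective P y \<le> primal_objective P x_hat"
proof -
  have "bdd_below ((\<lambda>x. (A *v x - b) \<bullet> y + \<mu> / 2 * (norm x)\<^sup>2) ` cball 0 R_X)"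
    by (intro bounded_imp_bdd_below compact_imp_bounded compact_continuous_image
        continuous_intros compact_cball linear_continuous_on)
  then have "(INF x\<in>cball 0 R_X. (A *v x - b) \<bullet> y + \<mu> / 2 * (norm x)\<^sup>2) \<le>
      (A *v x_hat - b) \<bullet> y + \<mu> / 2 * (norm x_hat)\<^sup>2"
    using x_mem by (intro cINF_lower) auto
  then show ?thesis
    by (simp add: dual_objective_def primal_objective_at_solution primal_feasible)
qed

lemma unique_minimizer:
  "is_arg_min (primal_objective P) (\<lambda>x. x \<in> X_set P) x \<longleftrightarrow> x = x_hat"
proof
  assume "is_arg_min (primal_objective P) (\<lambda>x. x \<in> X_set P) x"
  then have "primal_objective P x \<le> primal_objective P x_hat"
    using x_mem by (auto simp: is_arg_min_linorder)
  then have "\<mu> / 2 * (norm (x - x_hat))\<^sup>2 \<le> 0"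
    using quadratic_growth[of x] by simp
  then show "x = x_hat"
    using pos by (simp add: mult_le_0_iff)
next
  assume "x = x_hat"
  moreover have "primal_objective P x_hat \<le> primal_objective P z" for z
  proof -
    have "0 \<le> \<mu> / 2 * (norm (z - x_hat))\<^sup>2"
      using pos by simp
    then show ?thesis
      using quadratic_growth[of z] by linarith
  qed
  ultimately show "is_arg_min (primal_objective P) (\<lambda>x. x \<in> X_set P) x"
    using x_mem by (simp add: is_arg_min_linorder)
qed

lemma duality_gap_ge:
  "primal_objective P x - dual_objective P y \<ge> \<mu> / 2 * (norm (x - x_hat))\<^sup>2"
  using quadratic_growth[of x] weak_duality[of y] by linarith

end

text \<open>Stationarity forces the factor \<open>L / (2 * \<mu>)\<close> of the primal solution,
  and feasibility then fixes the multiple of \<open>u 1\<close>. The radii are crude bounds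
  depending only on \<open>L\<close>, \<open>\<mu>\<close> and \<open>N\<close>, so they can be
  fixed before \<open>u\<close> and \<open>v\<close> are known.\<close>

lemma quadratic_saddle_chain:
  fixes u :: "nat \<Rightarrow> real ^ 'm" and v :: "nat \<Rightarrow> real ^ 'n"
  assumes u: "orthonormal_upto N u" and v: "orthonormal_upto N v"
    and "1 \<le> N" "0 < \<mu>" "0 \<le> L"
  shows "quadratic_saddle \<mu> (L / (2 * \<mu>) * real N) (real N * sqrt (real N))
    (matrix (chain_map L N u v)) ((L\<^sup>2 / (4 * \<mu>)) *\<^sub>R u 1)
    ((L / (2 * \<mu>)) *\<^sub>R (\<Sum>j=1..N. v j)) (- (\<Sum>j=1..N. (real N + 1 - real j) *\<^sub>R u j))"
proof
  have "norm (v j) = 1" if "j \<le> N" for j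
    using orthonormal_uptoD[OF v that that] by (simp add: norm_eq_1)
  then have "norm (\<Sum>j=1..N. v j) \<le> real N"
    using norm_sum[of v "{1..N}"] by simp
  then show "norm ((L / (2 * \<mu>)) *\<^sub>R (\<Sum>j=1..N. v j)) \<le> L / (2 * \<mu>) * real N"
    using assms(4,5) by (simp add: divide_right_mono mult_left_mono)
  have "(norm (\<Sum>j=1..N. (real N + 1 - real j) *\<^sub>R u j))\<^sup>2 = (\<Sum>j=1..N. (real N + 1 - real j)\<^sup>2)"
    using u by (intro norm_orthonormal_sum) auto
  also have "\<dots> \<le> (\<Sum>j=1..N. (real N)\<^sup>2)"
    by (intro sum_mono power_mono) auto
  also have "\<dots> = (real N * sqrt (real N))\<^sup>2"
    by (simp add: power_mult_distrib)
  finally show "norm (- (\<Sum>j=1..N. (real N + 1 - real j) *\<^sub>R u j)) \<le> real N * sqrt (real N)"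
    unfolding norm_minus_cancel by (rule power2_le_imp_le) simp
  show "matrix (chain_map L N u v) *v ((L / (2 * \<mu>)) *\<^sub>R (\<Sum>j=1..N. v j)) = (L\<^sup>2 / (4 * \<mu>)) *\<^sub>R u 1"
    unfolding matrix_chain_map chain_map_sum[OF v \<open>1 \<le> N\<close>] by (simp add: power2_eq_square)
  show "transpose (matrix (chain_map L N u v)) *v (- (\<Sum>j=1..N. (real N + 1 - real j) *\<^sub>R u j)) =
      - (\<mu> *\<^sub>R (L / (2 * \<mu>)) *\<^sub>R (\<Sum>j=1..N. v j))"
    unfolding vec.neg matrix_chain_map using cochain_map_sum[OF u, of L v] \<open>0 < \<mu>\<close> by simp
qed fact

section \<open>The lower bound\<close>

theorem theorem10:
  fixes M :: "('n::finite, 'm::finite) scheme" and t :: nat and \<mu> L_A :: real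
  assumes "8 < CARD('m)" and "CARD('m) \<le> CARD('n)"
    and "0 < t" and "real t < real CARD('m) / 4 - 2"
    and "0 < \<mu>" and "0 < L_A"
    and "first_order_method M"
  shows "\<exists>(P :: ('n, 'm) problem) c_X c_Y R_X R_Y x_hat.
    bilinear_saddle_point_problem P \<and>
    strongly_convex \<mu> (f_fun P) \<and>
    spectral_norm (A_mat P) = L_A \<and>
    0 < R_X \<and> X_set P = cball c_X R_X \<and>
    0 < R_Y \<and> Y_set P = cball c_Y R_Y \<and>
    (\<forall>x. is_arg_min (primal_objective P) (\<lambda>x. x \<in> X_set P) x \<longleftrightarrow> x = x_hat) \<and>
    (norm (fst (approx_solution M P t) - x_hat))\<^sup>2
      \<ge> 5 * L_A\<^sup>2 * R_Y\<^sup>2 / (256 * \<mu>\<^sup>2 * (4 * real t + 9)\<^sup>2) \<and>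
    primal_objective P (fst (approx_solution M P t))
        - dual_objective P (snd (approx_solution M P t))
      \<ge> 5 * L_A\<^sup>2 * R_Y\<^sup>2 / (512 * \<mu> * (4 * real t + 9)\<^sup>2)"
proof -
  \<comment> \<open>Of the \<open>2 * t\<close> chain vectors, the method leaves \<open>t\<close>
    untouched. The adversary needs \<open>3 * t + 1\<close> below both dimensions, while the
    hypothesis gives \<open>4 * t + 8 < CARD('m)\<close>.\<close>
  define N where "N = 2 * t"
  define R_X where "R_X = L_A / (2 * \<mu>) * real N"
  define R_Y where "R_Y = real N * sqrt (real N)"
  have dims: "N + Suc t < CARD('m)" "N + Suc t < CARD('n)"
    using assms(2,4) unfolding N_def by linarith+
  obtain u0 :: "nat \<Rightarrow> real ^ 'm" where u0: "orthonormal_upto N u0"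
    using orthonormal_exists[of N, where 'a = "real ^ 'm"] dims by auto
  obtain v0 :: "nat \<Rightarrow> real ^ 'n" where v0: "orthonormal_upto N v0"
    using orthonormal_exists[of N, where 'a = "real ^ 'n"] dims by auto
  define b where "b = (L_A\<^sup>2 / (4 * \<mu>)) *\<^sub>R u0 1"
  \<comment> \<open>The zero matrix is a placeholder: the known information does not depend on the
    matrix.\<close>
  define \<theta> where "\<theta> = known (quadratic_problem \<mu> R_X R_Y (0 :: real ^ 'n ^ 'm) b)"
  \<comment> \<open>The output after \<open>t\<close> answers is treated as inquiry number \<open>t\<close>.\<close>
  define F where "F h = (if h = [] then initial_point M \<theta>
    else (if length h = t then snd else fst) (update_rule M (length h - 1) \<theta> h))" for h
  \<comment> \<open>There are \<open>Suc t\<close> inquiries: the true ones numbered below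
    \<open>t\<close> and the output in place of number \<open>t\<close>.\<close>
  obtain u v where u: "orthonormal_upto N u" and v: "orthonormal_upto N v" and u1: "u 1 = u0 1"
    and orth: "\<forall>i<Suc t. \<forall>j\<le>N.
      (i < j \<longrightarrow> v j \<bullet> fst (F (answers F (chain_oracle \<mu> L_A N u v) i)) = 0) \<and>
      (Suc i < j \<longrightarrow> u j \<bullet> snd (F (answers F (chain_oracle \<mu> L_A N u v) i)) = 0)"
    using resisting_answers[OF u0 v0, of "Suc t" F \<mu> L_A] dims assms(3) by (auto simp: N_def)
  define A where "A = matrix (chain_map L_A N u v)"
  define P where "P = quadratic_problem \<mu> R_X R_Y A b"
  define x_hat where "x_hat = (L_A / (2 * \<mu>)) *\<^sub>R (\<Sum>j=1..N. v j)"
  interpret quadratic_saddle \<mu> R_X R_Y A b x_hat "- (\<Sum>j=1..N. (real N + 1 - real j) *\<^sub>R u j)"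
    unfolding R_X_def R_Y_def A_def b_def x_hat_def u1[symmetric]
    using u v assms by (intro quadratic_saddle_chain) (auto simp: N_def)
  have known: "known P = \<theta>"
    unfolding P_def \<theta>_def by (rule known_quadratic_problem)
  have oracle_eq: "first_order_oracle P = chain_oracle \<mu> L_A N u v"
    unfolding fun_eq_iff first_order_oracle_def chain_oracle_def P_def A_def
      quadratic_problem_simps gradient_quadratic matrix_chain_map by simp
  \<comment> \<open>For \<open>k < t\<close> all inquiries entering the history come from lists
    shorter than \<open>t\<close>, where \<open>F\<close> follows the method. At length
    \<open>t\<close> it returns the output of rule \<open>t - 1\<close>.\<close>
  have "history M P k = answers F (chain_oracle \<mu> L_A N u v) (Suc k)" if "k < t" for k
    using that by (induction k) (auto simp: known oracle_eq F_def)
  from this[of "t - 1"] have "approx_solution M P t = F (answers F (chain_oracle \<mu> L_A N u v) t)"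
    using \<open>0 < t\<close> by (auto simp: approx_solution_def known F_def)
  then have x_orth: "v j \<bullet> fst (approx_solution M P t) = 0" if "t < j" "j \<le> N" for j
    using orth that by simp
  define x where "x = fst (approx_solution M P t)"
  have v_hat: "v j \<bullet> x_hat = L_A / (2 * \<mu>)" if "1 \<le> j" "j \<le> N" for j
    unfolding x_hat_def using inner_orthonormal_sum[OF v, of "{1..N}" j "\<lambda>_. 1"] that by auto
  \<comment> \<open>On these \<open>t\<close> indices the output has component 0 and
    \<open>x_hat\<close> has component \<open>L_A / (2 * \<mu>)\<close>.\<close>
  have "(\<Sum>j=Suc t..N. (v j \<bullet> (x - x_hat))\<^sup>2) = (\<Sum>j=Suc t..N. (L_A / (2 * \<mu>))\<^sup>2)"
    by (intro sum.cong) (auto simp: inner_diff_right x_def x_orth v_hat)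
  also have "\<dots> = real t * (L_A / (2 * \<mu>))\<^sup>2"
    by (simp add: N_def)
  finally have dist: "real t * (L_A / (2 * \<mu>))\<^sup>2 \<le> (norm (x - x_hat))\<^sup>2"
    using bessel_inequality[OF v, of "{Suc t..N}" "x - x_hat"] by auto
  have R_Y2: "R_Y\<^sup>2 = 8 * real t ^ 3"
    by (simp add: R_Y_def N_def power_mult_distrib power2_eq_square power3_eq_cube)
  \<comment> \<open>The required comparison after clearing denominators; with the value of
    \<open>R_Y\<close> it reads \<open>40 * t^3 <= 64 * t * (4 * t + 9)^2\<close>.\<close>
  have "5 * R_Y\<^sup>2 \<le> 64 * real t * (4 * real t + 9)\<^sup>2"
  proof -
    have "(real t)\<^sup>2 \<le> (4 * real t + 9)\<^sup>2"
      by (intro power_mono) auto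
    then have "40 * real t * (real t)\<^sup>2 \<le> 64 * real t * (4 * real t + 9)\<^sup>2"
      by (intro mult_mono) auto
    then show ?thesis
      unfolding R_Y2 by (simp add: power2_eq_square power3_eq_cube mult_ac)
  qed
  then have "L_A\<^sup>2 * (5 * R_Y\<^sup>2) \<le> L_A\<^sup>2 * (64 * real t * (4 * real t + 9)\<^sup>2)"
    by (intro mult_left_mono) auto
  then have "5 * L_A\<^sup>2 * R_Y\<^sup>2 / (256 * \<mu>\<^sup>2 * (4 * real t + 9)\<^sup>2) \<le> real t * (L_A / (2 * \<mu>))\<^sup>2"
    using \<open>0 < \<mu>\<close> by (simp add: divide_simps power_mult_distrib mult_ac)
  with dist have bound:
    "5 * L_A\<^sup>2 * R_Y\<^sup>2 / (256 * \<mu>\<^sup>2 * (4 * real t + 9)\<^sup>2) \<le> (norm (x - x_hat))\<^sup>2"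
    by linarith
  have "5 * L_A\<^sup>2 * R_Y\<^sup>2 / (512 * \<mu> * (4 * real t + 9)\<^sup>2) =
      \<mu> / 2 * (5 * L_A\<^sup>2 * R_Y\<^sup>2 / (256 * \<mu>\<^sup>2 * (4 * real t + 9)\<^sup>2))"
    using \<open>0 < \<mu>\<close> by (simp add: power2_eq_square)
  also have "\<dots> \<le> \<mu> / 2 * (norm (x - x_hat))\<^sup>2"
    using bound \<open>0 < \<mu>\<close> by (intro mult_left_mono) auto
  also have "\<dots> \<le> primal_objective P x - dual_objective P (snd (approx_solution M P t))"
    unfolding P_def by (rule duality_gap_ge)
  finally have gap: "5 * L_A\<^sup>2 * R_Y\<^sup>2 / (512 * \<mu> * (4 * real t + 9)\<^sup>2) \<le>
      primal_objective P x - dual_objective P (snd (approx_solution M P t))" .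
  have "spectral_norm (A_mat P) = L_A"
    using onorm_chain_map[OF u v, of L_A] \<open>0 < L_A\<close>
    by (simp add: spectral_norm_def P_def A_def matrix_chain_map)
  moreover have "0 < R_X" "0 < R_Y"
    using assms(3,5,6) by (auto simp: R_X_def R_Y_def N_def)
  moreover have "bilinear_saddle_point_problem P"
    using bilinear_quadratic_problem[of \<mu> R_X R_Y A b] R_nonneg \<open>0 < \<mu>\<close> by (simp add: P_def)
  moreover have "strongly_convex \<mu> (f_fun P)"
    unfolding P_def quadratic_problem_simps by (rule strongly_convex_quadratic)
  moreover have "X_set P = cball 0 R_X" "Y_set P = cball 0 R_Y"
    by (simp_all add: P_def)
  moreover have "\<forall>x. is_arg_min (primal_objective P) (\<lambda>x. x \<in> X_set P) x \<longleftrightarrow> x = x_hat"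
    unfolding P_def using unique_minimizer by blast
  ultimately show ?thesis
    using bound gap unfolding x_def by blast
qed

end
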